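(* Let $R$ be an associative ring, $a\in R$, and $n$ a positive integer. Suppose that $x\in R$ is the $\{1^{n},3,5\}$-inverse of $a$, and set $z=a+x-v$ where $v=a^{2}x$. Then $z$ is the unique $\{1^{n},4,5\}$-inverse of $a$.
   Context: For an element $a$ of an associative ring $R$ and a positive integer $n$, consider the following equations in the unknown $x\in R$: $(1^{n})$: $a^{n}xa=a^{n}$; $(3)$: $xax=x$; $(4)$: $xax-axa=x-a$; $(5)$: $ax=xa$. For a subset $U\subseteq\{1^{n},3,4,5\}$, an element $x\in R$ is called a $U$-inverse of $a$ if $x$ satisfies equation $(i)$ for every $i\in U$. A $\{1^{n},3,5\}$-inverse of $a$ is unique whenever it exists (it is the Drazin inverse of $a$). A $\{1^{n},4,5\}$-inverse of $a$ for some positive integer $n$ is called the complete inverse of $a$. *)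

theory Defs
  imports Main
begin

text \<open>
  Rings are associative and need not have a unit (class \<^class>\<open>ring\<close>), so the library power
  operation is not available and powers with positive exponent are defined directly.
  The value at exponent 0 is meaningless.
\<close>

definition pos_power :: "'a::semigroup_mult \<Rightarrow> nat \<Rightarrow> 'a" where
  "pos_power a n = ((\<lambda>y. a * y) ^^ (n - 1)) a"

lemma pos_power_one: "pos_power a 1 = a"
  by (simp add: pos_power_def)

lemma pos_power_Suc: "n \<ge> 1 \<Longrightarrow> pos_power a (Suc n) = a * pos_power a n"
  by (cases n) (simp_all add: pos_power_def)

lemma pos_power_eq_power:
  fixes a :: "'a::monoid_mult"
  shows "n \<ge> 1 \<Longrightarrow> pos_power a n = a ^ n"
  by (induction n rule: nat_induct_at_least) (simp_all add: pos_power_Suc pos_power_one [unfolded One_nat_def])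

datatype eq_label = Eq1 nat | Eq3 | Eq4 | Eq5

text \<open>\<open>Eq1 n\<close> is the label written $1^n$, used for positive \<open>n\<close> only.\<close>

primrec satisfies_eq :: "'a::ring \<Rightarrow> 'a \<Rightarrow> eq_label \<Rightarrow> bool" where
  "satisfies_eq a x (Eq1 n) \<longleftrightarrow> pos_power a n * x * a = pos_power a n"
| "satisfies_eq a x Eq3 \<longleftrightarrow> x * a * x = x"
| "satisfies_eq a x Eq4 \<longleftrightarrow> x * a * x - a * x * a = x - a"
| "satisfies_eq a x Eq5 \<longleftrightarrow> a * x = x * a"

definition is_U_inverse :: "eq_label set \<Rightarrow> 'a::ring \<Rightarrow> 'a \<Rightarrow> bool" where
  "is_U_inverse U a x \<longleftrightarrow> (\<forall>i\<in>U. satisfies_eq a x i)"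

end

theory Submission
  imports Defs
begin

text \<open>
  Put \<open>e = a * x\<close>, an idempotent with \<open>a\<^sup>n * e = a\<^sup>n\<close>. For an inverse \<open>y\<close> that satisfies
  (4) and (5), equation (4) reads \<open>y - a = p * (y - a)\<close> with \<open>p = a * y\<close>, so
  \<open>y - a = p\<^sup>n * (y - a)\<close>. Equation (1) gives \<open>e * p = e\<close> and \<open>e * y = x\<close>, and
  \<open>p\<^sup>n = a\<^sup>n * y\<^sup>n\<close> absorbs \<open>e\<close> on the left, hence \<open>p\<^sup>n = e\<close> and
  \<open>y - a = e * (y - a) = x - a\<^sup>2 * x\<close>.
\<close>

lemma pos_power_commutes:
  fixes a b :: "'a::semigroup_mult"
  assumes "a * b = b * a"
  shows "pos_power a n * b = b * pos_power a n"
proof (cases "n \<ge> 1")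
  case True
  then show ?thesis
    by (induction n rule: nat_induct_at_least)
      (simp_all add: pos_power_Suc pos_power_one [unfolded One_nat_def] assms mult.assoc,
        simp add: assms mult.assoc [symmetric])
\<comment> \<open>Truncated subtraction makes \<open>pos_power a 0\<close> equal to
  \<open>a\<close>, so exponent 0 is the hypothesis itself.\<close>
qed (simp add: pos_power_def assms)

lemma pos_power_mult_distrib:
  fixes a b :: "'a::semigroup_mult"
  assumes ab: "a * b = b * a" and "n \<ge> 1"
  shows "pos_power (a * b) n = pos_power a n * pos_power b n"
  using \<open>n \<ge> 1\<close>
proof (induction n rule: nat_induct_at_least)
  case (Suc n)
  have "pos_power (a * b) (Suc n) = a * (b * pos_power a n) * pos_power b n"
    using Suc by (simp add: pos_power_Suc mult.assoc)
  also have "b * pos_power a n = pos_power a n * b"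
    by (simp add: pos_power_commutes [OF ab])
  finally show ?case
    using Suc by (simp add: pos_power_Suc mult.assoc)
qed (simp add: pos_power_one [unfolded One_nat_def])

lemma pos_power_fix_left:
  fixes p d :: "'a::semigroup_mult"
  assumes "p * d = d" "n \<ge> 1"
  shows "pos_power p n * d = d"
  using \<open>n \<ge> 1\<close>
  by (induction n rule: nat_induct_at_least)
    (simp_all add: pos_power_Suc pos_power_one [unfolded One_nat_def] assms(1) mult.assoc)

lemma pos_power_fix_right:
  fixes p e :: "'a::semigroup_mult"
  assumes "e * p = e" "n \<ge> 1"
  shows "e * pos_power p n = e"
  using \<open>n \<ge> 1\<close>
  by (induction n rule: nat_induct_at_least)
    (simp_all add: pos_power_Suc pos_power_one [unfolded One_nat_def] assms(1) mult.assoc [symmetric])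

lemma pos_power_idempotent:
  fixes e :: "'a::semigroup_mult"
  assumes "e * e = e" "n \<ge> 1"
  shows "pos_power e n = e"
  using \<open>n \<ge> 1\<close>
  by (induction n rule: nat_induct_at_least)
    (simp_all add: pos_power_Suc pos_power_one [unfolded One_nat_def] assms(1))

theorem theorem2p2:
  fixes a x v z :: "'a::ring" and n :: nat
  assumes "n \<ge> 1"
    and "is_U_inverse {Eq1 n, Eq3, Eq5} a x"
    and "v = pos_power a 2 * x"
    and "z = a + x - v"
  shows "is_U_inverse {Eq1 n, Eq4, Eq5} a z \<and>
         (\<forall>y. is_U_inverse {Eq1 n, Eq4, Eq5} a y \<longrightarrow> y = z)"
proof -
  define P where "P = pos_power a n"
  define X where "X = pos_power x n"
  have Pxa: "P * x * a = P" and xax: "x * a * x = x" and ax: "a * x = x * a"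
    using assms(2) by (simp_all add: is_U_inverse_def P_def)
  have v: "v = a * (a * x)"
    using assms(3) by (simp add: pos_power_def mult.assoc numeral_2_eq_2)
  have xa': "x * (a * w) = a * (x * w)" for w
    by (metis ax mult.assoc)
  have axx: "a * (x * x) = x"
    using xax by (simp add: mult.assoc xa')
  have axx': "a * (x * (x * w)) = x * w" for w
    by (metis axx mult.assoc)
  \<comment> \<open>These rules carry every \<open>a\<close> to the left of every \<open>x\<close>
    and then collapse \<open>a * x * x\<close> to \<open>x\<close>, so words in \<open>a\<close> and
    \<open>x\<close> reach a normal form and identities between them become linear
    bookkeeping.\<close>
  note norm = mult.assoc ax [symmetric] xa' axx axx'
  have ee: "a * x * (a * x) = a * x"
    by (simp add: norm)
  have Pe: "P * (a * x) = P"
    using Pxa by (simp add: norm)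
  have Pa: "P * a = a * P"
    unfolding P_def by (rule pos_power_commutes) simp
  \<comment> \<open>\<open>X\<close> inverts \<open>P\<close> relative to the idempotent
    \<open>a * x\<close>: multiplying by \<open>X\<close> turns a left factor \<open>P\<close> into
    \<open>a * x\<close>.\<close>
  have XP: "X * P = a * x"
    using pos_power_mult_distrib [OF ax [symmetric] assms(1)] pos_power_idempotent [OF ee assms(1)] ax
    by (simp add: X_def P_def)
  have PX: "P * X = a * x"
    using pos_power_mult_distrib [OF ax assms(1)] pos_power_idempotent [OF ee assms(1)]
    by (simp add: X_def P_def)
  have az: "a * z = z * a"
    by (simp add: assms(4) v algebra_simps norm)
  \<comment> \<open>Under \<open>P\<close> the summands \<open>a\<close> and \<open>-v\<close> of
    \<open>z\<close> cancel, which reduces (1) for \<open>z\<close> to (1) for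
    \<open>x\<close>.\<close>
  have Pvw: "P * (v * a) = P * (a * a)"
  proof -
    have "P * (v * a) = P * (a * x) * (a * a)"
      by (simp add: v norm)
    then show ?thesis by (simp add: Pe mult.assoc)
  qed
  have "P * z * a = P * x * a + (P * (a * a) - P * (v * a))"
    by (simp add: assms(4) algebra_simps)
  then have z1: "P * z * a = P"
    by (simp add: Pvw Pxa)
  have z4: "z * a * z - a * z * a = z - a"
    by (simp add: assms(4) v algebra_simps norm)
  have "is_U_inverse {Eq1 n, Eq4, Eq5} a z"
    using az z1 z4 by (simp add: is_U_inverse_def P_def)
  moreover have "y = z" if "is_U_inverse {Eq1 n, Eq4, Eq5} a y" for y
  proof -
    have Pya: "P * y * a = P" and y4: "y * a * y - a * y * a = y - a" and ay: "a * y = y * a"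
      using that unfolding is_U_inverse_def P_def ball_simps satisfies_eq.simps by blast+
    have Py: "P * y = y * P"
      unfolding P_def by (rule pos_power_commutes) (rule ay)
    have eya: "a * x * y * a = a * x"
      by (metis XP Pya mult.assoc)
    \<comment> \<open>Moving \<open>P\<close> to the right of \<open>y\<close> lets it absorb a
      factor \<open>a * x\<close> there. Once \<open>P\<close> is moved back, \<open>y\<close>
      stands next to that new \<open>a\<close>, and \<open>eya\<close> removes it.\<close>
    have "a * x * y = X * y * P"
      by (metis XP Py mult.assoc)
    also have "\<dots> = X * y * P * (a * x)"
      by (metis Pe mult.assoc)
    also have "\<dots> = a * x * y * a * x"
      by (metis XP Py mult.assoc)
    also have "\<dots> = x"
      by (simp only: eya) (simp only: ax xax)
    finally have ey: "a * x * y = x" .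
    have ep: "a * x * (a * y) = a * x"
      using eya by (simp add: ay mult.assoc)
    have "pos_power (a * y) n = P * pos_power y n"
      unfolding P_def by (rule pos_power_mult_distrib [OF ay assms(1)])
    \<comment> \<open>The idempotent also fixes \<open>P\<close> from the left, since
      \<open>P = P * (X * P) = (P * X) * P\<close>.\<close>
    moreover have "P = a * x * P"
      by (metis PX XP Pe mult.assoc)
    ultimately have "pos_power (a * y) n = a * x * pos_power (a * y) n"
      by (metis mult.assoc)
    then have pn: "pos_power (a * y) n = a * x"
      by (simp add: pos_power_fix_right [OF ep assms(1)])
    have "a * y * (y - a) = y - a"
      using y4 by (simp add: right_diff_distrib ay mult.assoc)
    then have "y - a = a * x * (y - a)"
      using pos_power_fix_left [OF _ assms(1), of "a * y" "y - a"] by (simp add: pn)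
    also have "\<dots> = x - v"
      by (simp add: right_diff_distrib ey v) (simp add: norm)
    finally show ?thesis
      by (simp add: assms(4) algebra_simps)
  qed
  ultimately show ?thesis by blast
qed

end
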